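(* Let $n\ge 2$ and $N\ge 2$ be integers, let $h:[-1,1]\to[0,+\infty]$, and let $\{(\alpha_i,\rho_i)\}_{i=1}^{k}$ be a $1/N$-quadrature rule that is exact for a linear subspace $\Lambda\subset C([-1,1])$. (a) If $f\in\Lambda\cap A_{n,h}$, then $$\mathcal{E}(n,N;h)\ge N^2\sum_{i=1}^{k}\rho_i f(\alpha_i).$$ (b) We have $$\mathcal{W}(n,N,\Lambda;h)\le N^2\sum_{i=1}^{k}\rho_i h(\alpha_i).$$ Moreover, if there is some $f\in\Lambda\cap A_{n,h}$ such that $f(\alpha_i)=h(\alpha_i)$ for $i=1,\ldots,k$, then equality holds in the inequality of (b), which yields $$\mathcal{E}(n,N;h)\ge N^2\sum_{i=1}^{k}\rho_i h(\alpha_i).$$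
   Context: A spherical code is a finite set $C\subset\mathbb{S}^{n-1}$ (the unit sphere of $\mathbb{R}^n$). For $h:[-1,1]\to[0,+\infty]$, $E(C;h):=\sum_{x,y\in C,\,x\ne y}h(\langle x,y\rangle)$ (sum over ordered pairs) and $\mathcal{E}(n,N;h):=\inf\{E(C;h): C\subset\mathbb{S}^{n-1},\ |C|=N\}$. The Gegenbauer polynomials are $P_0^{(n)}=1$, $P_1^{(n)}=t$, $(i+n-2)P_{i+1}^{(n)}(t)=(2i+n-2)tP_i^{(n)}(t)-iP_{i-1}^{(n)}(t)$ for $i\ge1$; they are orthogonal on $[-1,1]$ with weight $(1-t^2)^{(n-3)/2}$ and $P_i^{(n)}(1)=1$. Put $\gamma_n:=\Gamma(n/2)/(\sqrt{\pi}\,\Gamma((n-1)/2))$ and, for $f\in C([-1,1])$, $f_0:=\gamma_n\int_{-1}^1 f(t)(1-t^2)^{(n-3)/2}\,dt$. $A_{n,h}$ is the set of functions $f:[-1,1]\to\mathbb{R}$ with $f(t)\le h(t)$ on $[-1,1]$ and $f(t)=\sum_{k=0}^\infty f_kP_k^{(n)}(t)$ with $f_k\ge0$ for all $k\ge1$ (so $f(1)=\sum_k f_k<\infty$, the series converges uniformly, and its zeroth coefficient agrees with the $f_0$ above). For a subspace $\Lambda\subset C([-1,1])$, $\mathcal{W}(n,N,\Lambda;h):=\sup_{f\in\Lambda\cap A_{n,h}}N^2\left(f_0-f(1)/N\right)$. A $1/N$-quadrature rule is a finite sequence $\{(\alpha_i,\rho_i)\}_{i=1}^k$ with $-1\le\alpha_1<\alpha_2<\cdots<\alpha_k<1$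 and $\rho_i>0$ for all $i$; it is exact for $\Lambda$ if $f_0=\frac{f(1)}{N}+\sum_{i=1}^k\rho_i f(\alpha_i)$ for all $f\in\Lambda$. *)

theory Defs
  imports "HOL-Analysis.Analysis" "HOL-Library.Function_Algebras"
begin

text \<open>
  The dimension \<open>n\<close> of the ambient space is a natural number; where an actual space is needed it
  is \<open>real ^ 'n\<close> with \<open>CARD('n) = n\<close>.  A function on \<open>[-1,1]\<close> is represented by a function on all
  of \<open>real\<close>: its values outside \<open>{-1..1}\<close> are irrelevant to every notion below.  Potentials take
  values in \<open>ereal\<close>; their nonnegativity on \<open>{-1..1}\<close> is a separate hypothesis.
\<close>

definition spherical_code :: "(real ^ 'n) set \<Rightarrow> bool" where
  "spherical_code C \<longleftrightarrow> finite C \<and> C \<subseteq> sphere 0 1"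

definition energy :: "(real ^ 'n) set \<Rightarrow> (real \<Rightarrow> ereal) \<Rightarrow> ereal" where
  "energy C h = (\<Sum>(x, y) \<in> {(x, y). x \<in> C \<and> y \<in> C \<and> x \<noteq> y}. h (x \<bullet> y))"

definition min_energy :: "'n::finite itself \<Rightarrow> nat \<Rightarrow> (real \<Rightarrow> ereal) \<Rightarrow> ereal" where
  "min_energy _ N h = (INF C \<in> {C :: (real ^ 'n) set. spherical_code C \<and> card C = N}. energy C h)"

text \<open>
  The recursion solved for the polynomial of highest index; the divisor \<open>i + n - 2\<close>, with
  \<open>i \<ge> 1\<close>, is positive for \<open>n \<ge> 2\<close>.
\<close>

fun gegenbauer :: "nat \<Rightarrow> nat \<Rightarrow> real \<Rightarrow> real" where
  "gegenbauer n 0 t = 1"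
| "gegenbauer n (Suc 0) t = t"
| "gegenbauer n (Suc (Suc i)) t =
     ((2 * real (Suc i) + real n - 2) * t * gegenbauer n (Suc i) t
       - real (Suc i) * gegenbauer n i t) / (real (Suc i) + real n - 2)"

definition gegenbauer_const :: "nat \<Rightarrow> real" where
  "gegenbauer_const n = Gamma (real n / 2) / (sqrt pi * Gamma ((real n - 1) / 2))"

text \<open>
  The coefficient \<open>f\<^sub>0\<close>.  At \<open>t = -1\<close> and \<open>t = 1\<close> the weight has the value \<open>0 powr a = 0\<close>; this
  convention does not affect the integral.
\<close>

definition zeroth_coeff :: "nat \<Rightarrow> (real \<Rightarrow> real) \<Rightarrow> real" where
  "zeroth_coeff n f =
     gegenbauer_const n * integral {-1..1} (\<lambda>t. f t * (1 - t\<^sup>2) powr ((real n - 3) / 2))"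

text \<open>The set \<open>A\<^bsub>n,h\<^esub>\<close>.  Taking \<open>t = 1\<close> in the expansion gives summability of the coefficients.\<close>

definition admissible :: "nat \<Rightarrow> (real \<Rightarrow> ereal) \<Rightarrow> (real \<Rightarrow> real) set" where
  "admissible n h =
     {f. (\<forall>t\<in>{-1..1}. ereal (f t) \<le> h t) \<and>
         (\<exists>c :: nat \<Rightarrow> real. (\<forall>k\<ge>1. c k \<ge> 0) \<and>
            (\<forall>t\<in>{-1..1}. (\<lambda>k. c k * gegenbauer n k t) sums f t))}"

text \<open>
  Linear subspaces of \<open>C([-1,1])\<close>.  Sum and zero of functions are the pointwise ones of
  \<^theory>\<open>HOL-Library.Function_Algebras\<close>.
\<close>

lemma vector_space_fun: "vector_space (\<lambda>(c::real) (f::real \<Rightarrow> real) t. c * f t)"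
  by unfold_locales (auto simp: fun_eq_iff algebra_simps)

definition continuous_subspace :: "(real \<Rightarrow> real) set \<Rightarrow> bool" where
  "continuous_subspace \<Lambda> \<longleftrightarrow>
     module.subspace (\<lambda>(c::real) f t. c * f t) \<Lambda> \<and> (\<forall>f\<in>\<Lambda>. continuous_on {-1..1} f)"

definition lp_bound :: "nat \<Rightarrow> nat \<Rightarrow> (real \<Rightarrow> real) set \<Rightarrow> (real \<Rightarrow> ereal) \<Rightarrow> ereal" where
  "lp_bound n N \<Lambda> h =
     (SUP f \<in> \<Lambda> \<inter> admissible n h. ereal ((real N)\<^sup>2 * (zeroth_coeff n f - f 1 / real N)))"

definition quadrature_rule :: "nat \<Rightarrow> (nat \<Rightarrow> real) \<Rightarrow> (nat \<Rightarrow> real) \<Rightarrow> bool" where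
  "quadrature_rule k \<alpha> \<rho> \<longleftrightarrow>
     strict_mono_on {1..k} \<alpha> \<and> (\<forall>i\<in>{1..k}. -1 \<le> \<alpha> i \<and> \<alpha> i < 1 \<and> \<rho> i > 0)"

definition quadrature_exact ::
    "nat \<Rightarrow> nat \<Rightarrow> nat \<Rightarrow> (nat \<Rightarrow> real) \<Rightarrow> (nat \<Rightarrow> real) \<Rightarrow> (real \<Rightarrow> real) set \<Rightarrow> bool" where
  "quadrature_exact n N k \<alpha> \<rho> \<Lambda> \<longleftrightarrow>
     (\<forall>f\<in>\<Lambda>. zeroth_coeff n f = f 1 / real N + (\<Sum>i=1..k. \<rho> i * f (\<alpha> i)))"

end

theory Submission
  imports Defs
begin

text \<open>
  The upper bound in (b) and its equality case are immediate: exactness of the quadrature turns the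
  objective \<open>N\<^sup>2 (f\<^sub>0 - f(1) / N)\<close> into \<open>N\<^sup>2 (\<Sum>i. \<rho>\<^sub>i f(\<alpha>\<^sub>i))\<close>, the weights are positive, and \<open>f \<le> h\<close>.
  The substance is the linear programming bound \<open>energy_lower_bound\<close>, that the objective at an
  admissible \<open>f\<close> is at most the \<open>h\<close>-energy of every code \<open>C\<close> of \<open>N\<close> points.  Summing the expansion
  of \<open>f\<close> over all pairs of \<open>C\<close> gives
  \<open>(\<Sum>x\<in>C. \<Sum>y\<in>C. f (x \<bullet> y)) = (\<Sum>k. f\<^sub>k (\<Sum>x\<in>C. \<Sum>y\<in>C. P\<^sub>k (x \<bullet> y))) \<ge> N\<^sup>2 f\<^sub>0\<close>,
  because the terms with \<open>k \<ge> 1\<close> are nonnegative; the diagonal contributes \<open>N f(1)\<close>, and off the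
  diagonal \<open>f \<le> h\<close>.  Two facts on Gegenbauer polynomials go into this.

  First, the kernel \<open>P\<^sub>k (x \<bullet> y)\<close> is positive definite on the sphere (Schoenberg).  The classical
  reason is the addition theorem: up to a positive factor the kernel is \<open>\<Sum>l. \<phi>\<^sub>l(x) \<phi>\<^sub>l(y)\<close> for a
  basis of spherical harmonics of degree \<open>k\<close>.  Lemma \<open>gegenbauer_features\<close> constructs such
  functions \<open>\<phi>\<^sub>l\<close> by induction on \<open>k\<close>.  If \<open>\<phi>\<close> is a harmonic of degree
  \<open>k\<close>, then \<open>(k + n - 2) x\<^sub>i \<phi> - \<nabla>\<^sub>i \<phi>\<close> is one of degree \<open>k + 1\<close>, where \<open>\<nabla>\<^sub>i\<close> is the \<open>i\<close>-th coordinate of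
  the gradient along the sphere.  Applying this operator in \<open>x\<close> and in \<open>y\<close> to the kernel of degree
  \<open>k\<close>, and summing over \<open>i\<close>, gives an expression in \<open>P\<^sub>k\<close>, \<open>P\<^sub>k'\<close>, \<open>P\<^sub>k''\<close> at \<open>x \<bullet> y\<close>, which the
  differential equation and the ladder relation reduce to a positive multiple of \<open>P\<^sub>k\<^sub>+\<^sub>1\<close>.

  Second, the zeroth coefficient of an expansion is the integral that defines \<open>f\<^sub>0\<close>
  (\<open>zeroth_coeff_expansion\<close>).  The differential equation exhibits \<open>P\<^sub>k\<close> times the weight as a
  derivative of a function that vanishes at both endpoints, hence \<open>P\<^sub>k\<close> is orthogonal to constants
  for \<open>k \<ge> 1\<close>; positive definiteness on two points gives \<open>\<bar>P\<^sub>k\<bar> \<le> 1\<close>, so dominated convergence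
  allows integrating term by term.
\<close>

section \<open>Differential identities of Gegenbauer polynomials\<close>

text \<open>
  The recursion again, now in the ring of polynomials, where derivatives are formal and nonzero
  factors cancel.
\<close>

fun gegenbauer_poly :: "nat \<Rightarrow> nat \<Rightarrow> real poly" where
  "gegenbauer_poly n 0 = 1"
| "gegenbauer_poly n (Suc 0) = [:0, 1:]"
| "gegenbauer_poly n (Suc (Suc i)) =
     smult (1 / (real (Suc i) + real n - 2))
       (smult (2 * real (Suc i) + real n - 2) ([:0, 1:] * gegenbauer_poly n (Suc i))
        - smult (real (Suc i)) (gegenbauer_poly n i))"

lemma poly_gegenbauer_poly [simp]: "poly (gegenbauer_poly n k) t = gegenbauer n k t"
  by (induction n k t rule: gegenbauer.induct) (simp_all add: field_simps)

lemma gegenbauer_at_1: "n \<ge> 2 \<Longrightarrow> gegenbauer n k 1 = 1"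
proof (induction n k "1::real" rule: gegenbauer.induct)
  case (3 n i)
  have "real (Suc i) + real n - 2 > 0" using 3(3) by simp
  with 3 show ?case by (simp add: field_simps)
qed auto

lemma gegenbauer_rec:
  assumes "n \<ge> 2"
  shows "(real k + real n - 1) * gegenbauer n (Suc (Suc k)) t =
    (2 * real k + real n) * t * gegenbauer n (Suc k) t - (real k + 1) * gegenbauer n k t"
  using assms by (simp add: field_simps)

lemma gegenbauer_rec_pderiv:
  assumes "n \<ge> 2"
  shows "(real k + real n - 1) * poly (pderiv (gegenbauer_poly n (Suc (Suc k)))) t =
    (2 * real k + real n) *
        (gegenbauer n (Suc k) t + t * poly (pderiv (gegenbauer_poly n (Suc k))) t)
      - (real k + 1) * poly (pderiv (gegenbauer_poly n k)) t"
  using assms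
  by (simp add: pderiv_smult pderiv_diff pderiv_mult pderiv_add pderiv_pCons field_simps)

text \<open>
  The two relations determine each other along the recursion: the second for \<open>k\<close> turns into the first
  for \<open>k + 1\<close> by the recursion, and the second for \<open>k + 1\<close> follows from both for \<open>k\<close> by
  differentiating the recursion.  They are therefore proved by one induction.
\<close>

lemma gegenbauer_ladder:
  assumes "n \<ge> 2"
  shows "(1 - t\<^sup>2) * poly (pderiv (gegenbauer_poly n k)) t =
           (real k + real n - 2) * (t * gegenbauer n k t - gegenbauer n (Suc k) t)" (is "?up k")
    and "(1 - t\<^sup>2) * poly (pderiv (gegenbauer_poly n (Suc k))) t =
           (real k + 1) * (gegenbauer n k t - t * gegenbauer n (Suc k) t)" (is "?down k")
proof -
  have "?up k \<and> ?down k"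
  proof (induction k)
    case 0
    show ?case by (simp add: pderiv_1 pderiv_pCons power2_eq_square)
  next
    case (Suc k)
    define p q r where "p = gegenbauer n k t" and "q = gegenbauer n (Suc k) t"
      and "r = gegenbauer n (Suc (Suc k)) t"
    define p' q' r' where "p' = poly (pderiv (gegenbauer_poly n k)) t"
      and "q' = poly (pderiv (gegenbauer_poly n (Suc k))) t"
      and "r' = poly (pderiv (gegenbauer_poly n (Suc (Suc k)))) t"
    note defs = p_def q_def r_def p'_def q'_def r'_def
    define K M where "K = real k" and "M = real n"
    have rec: "(K + M - 1) * r = (2 * K + M) * t * q - (K + 1) * p"
      using gegenbauer_rec[OF assms, of k t] unfolding defs K_def M_def .
    have rec': "(K + M - 1) * r' = (2 * K + M) * (q + t * q') - (K + 1) * p'"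
      using gegenbauer_rec_pderiv[OF assms, of k t] unfolding defs K_def M_def .
    have up: "(1 - t\<^sup>2) * p' = (K + M - 2) * (t * p - q)"
      and down: "(1 - t\<^sup>2) * q' = (K + 1) * (p - t * q)"
      using Suc unfolding defs K_def M_def by simp_all
    have ne: "K + M - 1 \<noteq> 0" using assms unfolding K_def M_def by simp
    have "(K + M - 1) * (t * q - r) = (K + 1) * (p - t * q)"
      using rec by algebra
    moreover have "(K + M - 1) * ((1 - t\<^sup>2) * r') = (K + M - 1) * ((K + 2) * (q - t * r))"
      using rec rec' up down by algebra
    hence "(1 - t\<^sup>2) * r' = (K + 2) * (q - t * r)" using ne by simp
    ultimately show ?case using down
      unfolding defs K_def M_def by (simp del: gegenbauer.simps gegenbauer_poly.simps add: add_ac)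
  qed
  thus "?up k" "?down k" by blast+
qed

text \<open>
  Differentiating the first ladder relation brings in the derivative of the next polynomial, which
  the second relation expresses only after multiplication by \<open>1 - t\<^sup>2\<close>.  The equation is thus
  obtained with this extra factor, and the factor is cancelled as a polynomial, so that the result
  also covers \<open>t = 1\<close> and \<open>t = -1\<close>.
\<close>

lemma gegenbauer_ode:
  assumes "n \<ge> 2"
  shows "(1 - t\<^sup>2) * poly (pderiv (pderiv (gegenbauer_poly n k))) t
      - (real n - 1) * t * poly (pderiv (gegenbauer_poly n k)) t
      + real k * (real k + real n - 2) * gegenbauer n k t = 0"
proof -
  define p q where "p = gegenbauer_poly n k" and "q = gegenbauer_poly n (Suc k)"
  define K M where "K = real k" and "M = real n"
  define E where "E = [:1, 0, -1:] * pderiv (pderiv p) - smult (M - 1) ([:0, 1:] * pderiv p)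
      + smult (K * (K + M - 2)) p"
  have up_poly: "[:1, 0, -1:] * pderiv p = smult (K + M - 2) ([:0, 1:] * p - q)"
    by (rule poly_ext)
       (use gegenbauer_ladder(1)[OF assms] in
         \<open>simp add: p_def q_def K_def M_def power2_eq_square algebra_simps\<close>)
  have up: "(1 - s\<^sup>2) * poly (pderiv p) s = (K + M - 2) * (s * poly p s - poly q s)"
    and down: "(1 - s\<^sup>2) * poly (pderiv q) s = (K + 1) * (poly p s - s * poly q s)" for s
    using gegenbauer_ladder[OF assms, of s k] by (simp_all add: p_def q_def K_def M_def)
  have up': "- 2 * s * poly (pderiv p) s + (1 - s\<^sup>2) * poly (pderiv (pderiv p)) s
      = (K + M - 2) * (poly p s + s * poly (pderiv p) s - poly (pderiv q) s)" for s
    using arg_cong[OF up_poly, of "\<lambda>r. poly (pderiv r) s"]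
    by (simp add: pderiv_mult pderiv_smult pderiv_diff pderiv_add pderiv_minus pderiv_pCons
        power2_eq_square algebra_simps)
  have E: "poly E s = (1 - s\<^sup>2) * poly (pderiv (pderiv p)) s - (M - 1) * s * poly (pderiv p) s
      + K * (K + M - 2) * poly p s" for s
    by (simp add: E_def power2_eq_square algebra_simps)
  have "(1 - s\<^sup>2) * poly E s = 0" for s
    using up[of s] down[of s] up'[of s] unfolding E by algebra
  hence "[:1, 0, -1:] * E = 0"
    by (intro poly_ext) (simp add: power2_eq_square algebra_simps)
  moreover have "[:1, 0, -1:] \<noteq> (0 :: real poly)" by simp
  ultimately have "E = 0" by (metis mult_eq_0_iff)
  hence "poly E t = 0" by simp
  thus ?thesis unfolding E by (simp add: p_def K_def M_def)
qed

section \<open>Tangential derivatives on the sphere\<close>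

lemma real_polynomial_function_partial:
  fixes f :: "real ^ 'n \<Rightarrow> real"
  assumes "real_polynomial_function f"
  shows "\<exists>g. (\<forall>i. real_polynomial_function (g i)) \<and>
      (\<forall>x. (f has_derivative (\<lambda>h. \<Sum>i\<in>UNIV. h $ i * g i x)) (at x))"
  using assms
proof (induction f rule: real_polynomial_function.induct)
  case (linear f)
  note bl = \<open>bounded_linear f\<close>
  interpret bounded_linear f by (fact bl)
  have expand: "f h = (\<Sum>i\<in>UNIV. h $ i * f (axis i 1))" for h
  proof -
    have "f h = f (\<Sum>i\<in>UNIV. h $ i *\<^sub>R axis i 1)"
      using basis_expansion[of h] by (simp add: scalar_mult_eq_scaleR)
    thus ?thesis by (simp add: sum scale)
  qed
  have "(\<lambda>h. \<Sum>i\<in>UNIV. h $ i * f (axis i 1)) = f"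
    by (rule ext, rule expand[symmetric])
  hence "\<forall>x. (f has_derivative (\<lambda>h. \<Sum>i\<in>UNIV. h $ i * f (axis i 1))) (at x)"
    using bounded_linear_imp_has_derivative[OF bl] by (simp only: simp_thms)
  thus ?case
    by (intro exI[of _ "\<lambda>i x. f (axis i 1)"]) (simp add: real_polynomial_function.intros(2))
next
  case (const c)
  show ?case by (intro exI[of _ "\<lambda>i x. 0"]) (simp add: real_polynomial_function.intros(2))
next
  case (add f1 f2)
  then obtain g1 g2 where g: "\<And>i. real_polynomial_function (g1 i)" "\<And>i. real_polynomial_function (g2 i)"
     "\<And>x. (f1 has_derivative (\<lambda>h. \<Sum>i\<in>UNIV. h $ i * g1 i x)) (at x)"
     "\<And>x. (f2 has_derivative (\<lambda>h. \<Sum>i\<in>UNIV. h $ i * g2 i x)) (at x)" by blast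
  have "((\<lambda>x. f1 x + f2 x) has_derivative (\<lambda>h. \<Sum>i\<in>UNIV. h $ i * (g1 i x + g2 i x))) (at x)" for x
    using has_derivative_add[OF g(3)[of x] g(4)[of x]]
    by (simp add: algebra_simps sum.distrib)
  thus ?case using g(1,2)
    by (intro exI[of _ "\<lambda>i x. g1 i x + g2 i x"]) (simp add: real_polynomial_function.intros(3))
next
  case (mult f1 f2)
  then obtain g1 g2 where g: "\<And>i. real_polynomial_function (g1 i)" "\<And>i. real_polynomial_function (g2 i)"
     "\<And>x. (f1 has_derivative (\<lambda>h. \<Sum>i\<in>UNIV. h $ i * g1 i x)) (at x)"
     "\<And>x. (f2 has_derivative (\<lambda>h. \<Sum>i\<in>UNIV. h $ i * g2 i x)) (at x)" by blast
  have "((\<lambda>x. f1 x * f2 x) has_derivative (\<lambda>h. \<Sum>i\<in>UNIV. h $ i * (f1 x * g2 i x + g1 i x * f2 x))) (at x)" for x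
    using has_derivative_mult[OF g(3)[of x] g(4)[of x]]
    by (simp add: algebra_simps sum.distrib sum_distrib_left sum_distrib_right)
  thus ?case using g(1,2) mult.hyps
    by (intro exI[of _ "\<lambda>i x. f1 x * g2 i x + g1 i x * f2 x"])
       (simp add: real_polynomial_function.intros(3) real_polynomial_function.intros(4))
qed

text \<open>
  Tangential derivatives depend only on the values on the sphere, since a tangent vector \<open>v\<close> at \<open>x\<close>
  is the velocity of a curve in the sphere, here \<open>x + t v\<close> scaled to norm 1.  This is what permits
  differentiating an identity known only on the sphere.
\<close>

lemma tangential_derivative_unique:
  fixes F G :: "'a::real_inner \<Rightarrow> real"
  assumes F: "(F has_derivative F') (at x)" and G: "(G has_derivative G') (at x)"
    and eq: "\<And>z. z \<in> sphere 0 1 \<Longrightarrow> F z = G z"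
    and x: "x \<in> sphere 0 1" and v: "x \<bullet> v = 0"
  shows "F' v = G' v"
proof -
  define r where "r = (\<lambda>t. inverse (sqrt (1 + t\<^sup>2 * (v \<bullet> v))))"
  define \<gamma> where "\<gamma> = (\<lambda>t::real. r t *\<^sub>R (x + t *\<^sub>R v))"
  have pos: "1 + t\<^sup>2 * (v \<bullet> v) > 0" for t :: real
    by (smt (verit) inner_ge_zero mult_nonneg_nonneg zero_le_power2)
  have xx: "x \<bullet> x = 1" using x by (simp add: norm_eq_1)
  have "\<gamma> t \<bullet> \<gamma> t = 1" for t
  proof -
    have "(x + t *\<^sub>R v) \<bullet> (x + t *\<^sub>R v) = 1 + t\<^sup>2 * (v \<bullet> v)"
      using xx v by (simp add: inner_add_left inner_add_right inner_commute power2_eq_square)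
    moreover have "r t * r t * (1 + t\<^sup>2 * (v \<bullet> v)) = 1"
      using pos[of t] by (simp add: r_def field_simps)
    ultimately show ?thesis by (simp add: \<gamma>_def mult.assoc)
  qed
  hence sph: "\<gamma> t \<in> sphere 0 1" for t by (simp add: norm_eq_1)
  have r': "(r has_real_derivative 0) (at 0)"
    unfolding r_def by (auto intro!: derivative_eq_intros)
  have \<gamma>0: "\<gamma> 0 = x" by (simp add: \<gamma>_def r_def)
  have "(\<gamma> has_derivative (\<lambda>s. s *\<^sub>R v)) (at 0)"
    unfolding \<gamma>_def
    by (rule derivative_eq_intros r'[unfolded has_field_derivative_def] refl)+
       (auto simp: r_def)
  hence \<gamma>': "(\<gamma> has_derivative (\<lambda>s. s *\<^sub>R v)) (at 0 within UNIV)" by simp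
  have "(F \<circ> \<gamma> has_derivative F' \<circ> (\<lambda>s. s *\<^sub>R v)) (at 0)"
    by (rule diff_chain_at) (use \<gamma>' F \<gamma>0 in auto)
  moreover have "(G \<circ> \<gamma> has_derivative G' \<circ> (\<lambda>s. s *\<^sub>R v)) (at 0)"
    by (rule diff_chain_at) (use \<gamma>' G \<gamma>0 in auto)
  moreover have "F \<circ> \<gamma> = G \<circ> \<gamma>" using eq sph by auto
  ultimately have "F' \<circ> (\<lambda>s. s *\<^sub>R v) = G' \<circ> (\<lambda>s. s *\<^sub>R v)"
    by (metis has_derivative_unique)
  thus ?thesis by (metis comp_apply scaleR_one)
qed

section \<open>Positive definiteness\<close>

lemma sum_lists_Suc:
  fixes F :: "'n::finite list \<Rightarrow> 'b::comm_monoid_add"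
  shows "(\<Sum>l | length l = Suc k. F l) = (\<Sum>i\<in>UNIV. \<Sum>l | length l = k. F (i # l))"
proof -
  have "{l :: 'n list. length l = Suc k} = (\<lambda>(i, l). i # l) ` (UNIV \<times> {l. length l = k})"
    by (auto simp: image_iff length_Suc_conv)
  moreover have "inj_on (\<lambda>(i, l). i # l) (UNIV \<times> {l :: 'n list. length l = k})"
    by (auto simp: inj_on_def)
  ultimately show ?thesis
    by (simp add: sum.reindex sum.cartesian_product case_prod_unfold)
qed

text \<open>
  The existence part of the addition theorem.  The lists \<open>l\<close> record the coordinates \<open>i\<close> at which the
  degree-raising operator has been applied; the resulting functions span the harmonics of degree \<open>k\<close>
  but are in general linearly dependent.  That each \<open>\<phi> l\<close> is a polynomial is carried through the induction to have derivatives at every stage.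
\<close>

lemma gegenbauer_features:
  assumes n: "n \<ge> 2" and card: "CARD('n::finite) = n"
  shows "\<exists>(\<phi> :: 'n list \<Rightarrow> real ^ 'n \<Rightarrow> real) c. (\<forall>l. real_polynomial_function (\<phi> l)) \<and> c > 0 \<and>
    (\<forall>x\<in>sphere 0 1. \<forall>y\<in>sphere 0 1.
       (\<Sum>l | length l = k. \<phi> l x * \<phi> l y) = c * gegenbauer n k (x \<bullet> y))"
proof (induction k)
  case 0
  show ?case
    by (intro exI[of _ "\<lambda>l x. 1"] exI[of _ 1]) (auto simp: real_polynomial_function.intros(2))
next
  case (Suc k)
  then obtain \<phi> :: "'n list \<Rightarrow> real ^ 'n \<Rightarrow> real" and c where
    \<phi>: "\<And>l. real_polynomial_function (\<phi> l)" and c: "c > 0" and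
    ker: "\<And>x y. x \<in> sphere 0 1 \<Longrightarrow> y \<in> sphere 0 1 \<Longrightarrow>
       (\<Sum>l | length l = k. \<phi> l x * \<phi> l y) = c * gegenbauer n k (x \<bullet> y)"
    by blast
  obtain g where g: "\<And>l i. real_polynomial_function (g l i)"
    and \<phi>': "\<And>l x. (\<phi> l has_derivative (\<lambda>h. \<Sum>i\<in>UNIV. h $ i * g l i x)) (at x)"
  proof -
    have "\<forall>l. \<exists>g. (\<forall>i. real_polynomial_function (g i)) \<and>
        (\<forall>x. (\<phi> l has_derivative (\<lambda>h. \<Sum>i\<in>UNIV. h $ i * g i x)) (at x))"
      using real_polynomial_function_partial[OF \<phi>] by blast
    from choice[OF this] show ?thesis using that by blast
  qed
  define P P' P'' where "P = gegenbauer n k" and "P' = poly (pderiv (gegenbauer_poly n k))"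
    and "P'' = poly (pderiv (pderiv (gegenbauer_poly n k)))"
  \<comment> \<open>\<open>u i x\<close> is the projection of the \<open>i\<close>-th unit vector to the tangent space at \<open>x\<close>, so that
    \<open>d l i x\<close> is the \<open>i\<close>-th coordinate of the gradient of \<open>\<phi> l\<close> along the sphere.\<close>
  define u :: "'n \<Rightarrow> real ^ 'n \<Rightarrow> real ^ 'n" where "u = (\<lambda>i x. axis i 1 - x $ i *\<^sub>R x)"
  define d where "d = (\<lambda>l i x. \<Sum>j\<in>UNIV. u i x $ j * g l j x)"
  \<comment> \<open>In degree \<open>0\<close> the gradient vanishes, and any positive factor serves; \<open>k + n - 2\<close> itself would be
    \<open>0\<close> for \<open>n = 2\<close>.\<close>
  define a where "a = (if k = 0 then 1 else real k + real n - 2)"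
  define \<psi> where "\<psi> = (\<lambda>l x. case l of [] \<Rightarrow> 0 | i # l \<Rightarrow> a * (x $ i * \<phi> l x) - d l i x)"

  have coord: "real_polynomial_function (\<lambda>x :: real ^ 'n. x $ i)" for i
    by (intro real_polynomial_function.intros(1) bounded_linear_vec_nth)
  have d_poly: "real_polynomial_function (d l i)" for l i
    unfolding d_def u_def vector_minus_component vector_scaleR_component real_scaleR_def
    by (intro real_polynomial_function_sum real_polynomial_function.intros(4) real_polynomial_function_diff
        real_polynomial_function.intros(2) coord g finite)
  have \<psi>_poly: "real_polynomial_function (\<psi> l)" for l
    unfolding \<psi>_def
    by (cases l; simp only: list.case)
       (intro real_polynomial_function.intros(4) real_polynomial_function_diff
          real_polynomial_function.intros(2) coord \<phi> d_poly)+

  have P_deriv: "(P has_real_derivative P' t) (at t)" for t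
    using poly_DERIV[of "gegenbauer_poly n k" t] unfolding P_def P'_def by simp
  have P'_deriv: "(P' has_real_derivative P'' t) (at t)" for t
    unfolding P'_def P''_def by (rule poly_DERIV)
  have u_tangent: "x \<bullet> u i x = 0" if "x \<in> sphere 0 1" for x i
    using that by (simp add: u_def inner_diff_right inner_axis norm_eq_1)
  have inner_u: "y \<bullet> u i x = y $ i - x $ i * (x \<bullet> y)" for x y i
    by (simp add: u_def inner_diff_right inner_axis inner_commute)

  \<comment> \<open>The kernel identity of degree \<open>k\<close> differentiated along the sphere in \<open>y\<close>, and then also in \<open>x\<close>.\<close>
  have one: "(\<Sum>l | length l = k. \<phi> l x * d l i y) = c * P' (x \<bullet> y) * (x $ i - y $ i * (x \<bullet> y))"
    if x: "x \<in> sphere 0 1" and y: "y \<in> sphere 0 1" for x y i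
  proof -
    have F: "((\<lambda>y. \<Sum>l | length l = k. \<phi> l x * \<phi> l y) has_derivative
        (\<lambda>h. \<Sum>l | length l = k. \<phi> l x * (\<Sum>j\<in>UNIV. h $ j * g l j y))) (at y)"
      by (intro has_derivative_sum has_derivative_mult_right \<phi>')
    have G: "((\<lambda>y. c * P (x \<bullet> y)) has_derivative (\<lambda>h. c * (P' (x \<bullet> y) * (x \<bullet> h)))) (at y)"
      by (intro has_derivative_mult_right has_derivative_compose[OF _ P_deriv[unfolded has_field_derivative_def]]
         has_derivative_inner_right has_derivative_ident)
    show ?thesis
      using tangential_derivative_unique[OF F G _ y u_tangent[OF y, of i]] ker[OF x]
      by (simp add: P_def d_def inner_u inner_commute)
  qed
  have two: "(\<Sum>l | length l = k. d l i x * d l i y) =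
      c * (P'' (x \<bullet> y) * (y $ i - x $ i * (x \<bullet> y)) * (x $ i - y $ i * (x \<bullet> y))
         + P' (x \<bullet> y) * (1 - (x $ i)\<^sup>2 - (y $ i)\<^sup>2 + x $ i * y $ i * (x \<bullet> y)))"
    if x: "x \<in> sphere 0 1" and y: "y \<in> sphere 0 1" for x y i
  proof -
    have F: "((\<lambda>x. \<Sum>l | length l = k. \<phi> l x * d l i y) has_derivative
        (\<lambda>h. \<Sum>l | length l = k. (\<Sum>j\<in>UNIV. h $ j * g l j x) * d l i y)) (at x)"
      by (intro has_derivative_sum has_derivative_mult_left \<phi>')
    have G: "((\<lambda>x. c * P' (x \<bullet> y) * (x $ i - y $ i * (x \<bullet> y))) has_derivative
        (\<lambda>h. c * P' (x \<bullet> y) * (h $ i - y $ i * (h \<bullet> y))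
            + c * (P'' (x \<bullet> y) * (h \<bullet> y)) * (x $ i - y $ i * (x \<bullet> y)))) (at x)"
      by (intro has_derivative_mult has_derivative_mult_right has_derivative_diff
         has_derivative_compose[OF _ P'_deriv[unfolded has_field_derivative_def]]
         has_derivative_inner_left has_derivative_ident
         bounded_linear.has_derivative[OF bounded_linear_vec_nth])
    have ui: "u i x $ i = 1 - (x $ i)\<^sup>2"
      by (simp add: u_def power2_eq_square)
    have "(\<Sum>l | length l = k. d l i x * d l i y) =
        c * P' (x \<bullet> y) * (u i x $ i - y $ i * (u i x \<bullet> y))
            + c * (P'' (x \<bullet> y) * (u i x \<bullet> y)) * (x $ i - y $ i * (x \<bullet> y))"
      using tangential_derivative_unique[OF F G _ x u_tangent[OF x, of i]] one[OF _ y]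
      by (simp add: d_def)
    thus ?thesis
      unfolding ui inner_commute[of "u i x" y] inner_u by (simp add: power2_eq_square algebra_simps)
  qed

  have "\<exists>c'>0. \<forall>x\<in>sphere 0 1. \<forall>y\<in>sphere 0 1.
       (\<Sum>l | length l = Suc k. \<psi> l x * \<psi> l y) = c' * gegenbauer n (Suc k) (x \<bullet> y)"
  proof -
    define c' where "c' = (if k = 0 then c else c * a * (2 * real k + real n - 2))"
    have "c' > 0" using c n by (auto simp: c'_def a_def intro!: mult_pos_pos)
    moreover have "(\<Sum>l | length l = Suc k. \<psi> l x * \<psi> l y) = c' * gegenbauer n (Suc k) (x \<bullet> y)"
      if x: "x \<in> sphere 0 1" and y: "y \<in> sphere 0 1" for x y
    proof -
      define t where "t = x \<bullet> y"
      have xx: "(\<Sum>i\<in>UNIV. x $ i * x $ i) = 1" and yy: "(\<Sum>i\<in>UNIV. y $ i * y $ i) = 1"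
        and xy: "(\<Sum>i\<in>UNIV. x $ i * y $ i) = t"
        using x y by (simp_all add: norm_eq_1 inner_vec_def t_def)
      have one': "(\<Sum>l | length l = k. d l i x * \<phi> l y) = c * P' t * (y $ i - x $ i * t)" for i
        using one[OF y x, of i] by (simp add: t_def inner_commute mult.commute)
      have "(\<Sum>l | length l = Suc k. \<psi> l x * \<psi> l y) =
         (\<Sum>i\<in>UNIV. a\<^sup>2 * (x $ i * y $ i) * (\<Sum>l | length l = k. \<phi> l x * \<phi> l y)
            - a * x $ i * (\<Sum>l | length l = k. \<phi> l x * d l i y)
            - a * y $ i * (\<Sum>l | length l = k. d l i x * \<phi> l y)
            + (\<Sum>l | length l = k. d l i x * d l i y))"
        unfolding sum_lists_Suc
        by (simp add: \<psi>_def sum_distrib_left sum_subtractf[symmetric] sum.distrib[symmetric]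
            power2_eq_square algebra_simps)
      also have "\<dots> = (\<Sum>i\<in>UNIV. c * ((a\<^sup>2 * P t + P'' t * (1 + t\<^sup>2) + P' t * t
             + 2 * a * t * P' t) * (x $ i * y $ i)
           + (- a * P' t - P'' t * t - P' t) * (x $ i * x $ i)
           + (- a * P' t - P'' t * t - P' t) * (y $ i * y $ i) + P' t))"
        unfolding one'
        by (intro sum.cong refl, unfold ker[OF x y] one[OF x y] two[OF x y] t_def[symmetric] P_def[symmetric])
           (simp add: power2_eq_square algebra_simps)
      also have "\<dots> = c * ((a\<^sup>2 * P t + P'' t * (1 + t\<^sup>2) + P' t * t + 2 * a * t * P' t) * t
           + 2 * (- a * P' t - P'' t * t - P' t) + real n * P' t)"
        by (simp only: sum.distrib sum_distrib_left[symmetric] xx yy xy)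
           (simp add: card algebra_simps)
      also have "\<dots> = c' * gegenbauer n (Suc k) t"
      proof (cases "k = 0")
        case True
        thus ?thesis by (simp add: c'_def a_def P_def P'_def P''_def)
      next
        case False
        hence a: "a = real k + real n - 2" by (simp add: a_def)
        have "(1 - t\<^sup>2) * P'' t - (real n - 1) * t * P' t + real k * a * P t = 0"
          using gegenbauer_ode[OF n, of t k] unfolding a P_def P'_def P''_def .
        moreover have "(1 - t\<^sup>2) * P' t = a * (t * P t - gegenbauer n (Suc k) t)"
          using gegenbauer_ladder(1)[OF n, of t k] unfolding a P_def P'_def .
        moreover have "c' = c * a * (a + real k)" using False by (simp add: c'_def a)
        moreover have "real n = a - real k + 2" by (simp add: a)
        ultimately show ?thesis by algebra
      qed
      finally show ?thesis unfolding t_def .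
    qed
    ultimately show ?thesis by blast
  qed
  with \<psi>_poly show ?case by blast
qed

text \<open>Up to the factor \<open>c\<close> the quadratic form is a sum of squares, one for each feature.\<close>

lemma gegenbauer_positive_definite:
  fixes C :: "(real ^ 'n::finite) set" and w :: "real ^ 'n \<Rightarrow> real"
  assumes n: "n \<ge> 2" and card: "CARD('n) = n" and C: "C \<subseteq> sphere 0 1"
  shows "0 \<le> (\<Sum>x\<in>C. \<Sum>y\<in>C. w x * w y * gegenbauer n k (x \<bullet> y))"
proof -
  obtain \<phi> :: "'n list \<Rightarrow> real ^ 'n \<Rightarrow> real" and c where c: "c > 0" and
    ker: "\<And>x y. x \<in> sphere 0 1 \<Longrightarrow> y \<in> sphere 0 1 \<Longrightarrow>
       (\<Sum>l | length l = k. \<phi> l x * \<phi> l y) = c * gegenbauer n k (x \<bullet> y)"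
    using gegenbauer_features[OF n card, of k] by blast
  have "c * (\<Sum>x\<in>C. \<Sum>y\<in>C. w x * w y * gegenbauer n k (x \<bullet> y)) =
      (\<Sum>x\<in>C. \<Sum>y\<in>C. w x * w y * (c * gegenbauer n k (x \<bullet> y)))"
    by (simp add: sum_distrib_left mult_ac)
  also have "\<dots> = (\<Sum>x\<in>C. \<Sum>y\<in>C. \<Sum>l | length l = k. (w x * \<phi> l x) * (w y * \<phi> l y))"
    using C by (intro sum.cong refl) (simp add: ker[symmetric] subset_iff sum_distrib_left mult_ac)
  also have "\<dots> = (\<Sum>x\<in>C. \<Sum>l | length l = k. \<Sum>y\<in>C. (w x * \<phi> l x) * (w y * \<phi> l y))"
    by (intro sum.cong refl sum.swap)
  also have "\<dots> = (\<Sum>l | length l = k. \<Sum>x\<in>C. \<Sum>y\<in>C. (w x * \<phi> l x) * (w y * \<phi> l y))"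
    by (rule sum.swap)
  also have "\<dots> = (\<Sum>l | length l = k. (\<Sum>x\<in>C. w x * \<phi> l x)\<^sup>2)"
    by (simp add: power2_eq_square sum_product)
  also have "\<dots> \<ge> 0" by (intro sum_nonneg) simp
  finally show ?thesis using c by (simp add: zero_le_mult_iff)
qed

lemma unit_vectors_with_inner_product:
  assumes "CARD('n::finite) \<ge> 2" and "\<bar>t\<bar> \<le> 1"
  obtains x y :: "real ^ 'n" where "x \<in> sphere 0 1" "y \<in> sphere 0 1" "x \<bullet> y = t"
proof -
  obtain i j :: 'n where ij: "i \<noteq> j"
    using assms(1) by (metis One_nat_def Suc_1 not_less_eq_eq card_le_Suc0_iff_eq finite)
  define x y :: "real ^ 'n" where "x = axis i 1"
    and "y = t *\<^sub>R axis i 1 + sqrt (1 - t\<^sup>2) *\<^sub>R axis j 1"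
  have "t\<^sup>2 \<le> 1" using assms(2) by (simp add: abs_square_le_1)
  hence "x \<bullet> x = 1" "y \<bullet> y = 1" "x \<bullet> y = t"
    using ij by (simp_all add: x_def y_def inner_add_left inner_add_right inner_axis_axis
        power2_eq_square[symmetric])
  thus ?thesis by (intro that[of x y]) (simp_all add: norm_eq_1)
qed

text \<open>
  Positive definiteness on two unit vectors with inner product \<open>t\<close>, with weights \<open>(1, 1)\<close> and
  \<open>(1, -1)\<close>.
\<close>

lemma abs_gegenbauer_le_1:
  assumes n: "n \<ge> 2" and card: "CARD('n::finite) = n" and t: "t \<in> {-1..1}"
  shows "\<bar>gegenbauer n k t\<bar> \<le> 1"
proof -
  have "CARD('n) \<ge> 2" "\<bar>t\<bar> \<le> 1" using assms by (auto simp: abs_le_iff)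
  then obtain x y :: "real ^ 'n" where xy: "x \<in> sphere 0 1" "y \<in> sphere 0 1" "x \<bullet> y = t"
    by (rule unit_vectors_with_inner_product)
  have xx: "x \<bullet> x = 1" "y \<bullet> y = 1" using xy by (simp_all add: norm_eq_1)
  show ?thesis
  proof (cases "x = y")
    case True
    thus ?thesis using xy xx gegenbauer_at_1[OF n] by simp
  next
    case False
    have "0 \<le> 2 + 2 * s * gegenbauer n k t" if "s\<^sup>2 = 1" for s
      using gegenbauer_positive_definite[OF n card, of "{x, y}" "\<lambda>z. if z = x then 1 else s" k]
        False xy xx that gegenbauer_at_1[OF n, of k]
      by (simp add: inner_commute power2_eq_square)
    from this[of 1] this[of "-1"] show ?thesis by simp
  qed
qed

section \<open>The zeroth coefficient\<close>

text \<open>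
  With \<open>a = (n - 1) / 2\<close>, the substitution \<open>u = (t + 1) / 2\<close> turns the integral into
  \<open>2\<^bsup>2a - 1\<^esup> Beta a a\<close>, and Legendre's duplication formula brings this to the form of the constant.
\<close>

lemma gegenbauer_weight_integral:
  assumes "n \<ge> 2"
  shows "((\<lambda>t. (1 - t\<^sup>2) powr ((real n - 3) / 2)) has_integral (1 / gegenbauer_const n)) {-1..1}"
proof -
  define a where "a = (real n - 1) / 2"
  have a: "a > 0" using assms by (simp add: a_def)
  have "((\<lambda>u. u powr (a - 1) * (1 - u) powr (a - 1)) has_integral Beta a a) (cbox 0 1)"
    using has_integral_Beta_real[OF a a] by simp
  from has_integral_affinity'[OF this, of "1/2" "1/2"]
  have "((\<lambda>t. ((t + 1) / 2) powr (a - 1) * (1 - (t + 1) / 2) powr (a - 1)) has_integral 2 * Beta a a) {-1..1}"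
    by (simp add: add_divide_distrib)
  hence "((\<lambda>t. 4 powr (a - 1) * (((t + 1) / 2) powr (a - 1) * (1 - (t + 1) / 2) powr (a - 1)))
      has_integral 4 powr (a - 1) * (2 * Beta a a)) {-1..1}"
    by (rule has_integral_mult_right)
  moreover have "4 powr (a - 1) * (((t + 1) / 2) powr (a - 1) * (1 - (t + 1) / 2) powr (a - 1))
      = (1 - t\<^sup>2) powr ((real n - 3) / 2)" if "t \<in> {-1..1}" for t
  proof -
    have "4 powr (a - 1) * (((t + 1) / 2) powr (a - 1) * (1 - (t + 1) / 2) powr (a - 1))
       = (4 * ((t + 1) / 2 * (1 - (t + 1) / 2))) powr (a - 1)"
    proof -
      have "(4 * (p * q)) powr (a - 1) = 4 powr (a - 1) * (p powr (a - 1) * q powr (a - 1))"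
        if "p \<ge> 0" "q \<ge> 0" for p q :: real
        using that by (simp add: powr_mult)
      from this[of "(t + 1) / 2" "1 - (t + 1) / 2"] show ?thesis using that by simp
    qed
    moreover have "4 * ((t + 1) / 2 * (1 - (t + 1) / 2)) = 1 - t\<^sup>2" by (simp add: power2_eq_square field_simps)
    moreover have "a - 1 = (real n - 3) / 2" by (simp add: a_def field_simps)
    ultimately show ?thesis by (simp only:)
  qed
  ultimately have int: "((\<lambda>t. (1 - t\<^sup>2) powr ((real n - 3) / 2)) has_integral 4 powr (a - 1) * (2 * Beta a a)) {-1..1}"
    by (subst has_integral_cong[OF _]) auto
  have pos: "Gamma a > 0" "Gamma (a + 1/2) > 0" "Gamma (2 * a) > 0"
    using a by (auto intro!: Gamma_real_pos)
  have dup: "Gamma a * Gamma (a + 1/2) = exp ((1 - 2 * a) * ln 2) * sqrt pi * Gamma (2 * a)"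
  proof -
    have "complex_of_real a \<notin> \<int>\<^sub>\<le>\<^sub>0" "complex_of_real a + 1/2 \<notin> \<int>\<^sub>\<le>\<^sub>0"
      using a by (auto elim!: nonpos_Ints_cases simp: complex_eq_iff)
    from Gamma_legendre_duplication[OF this]
    have "complex_of_real (Gamma a * Gamma (a + 1/2)) =
        complex_of_real (exp ((1 - 2 * a) * ln 2) * sqrt pi * Gamma (2 * a))"
      by (simp add: Gamma_complex_of_real[symmetric] exp_of_real[symmetric])
    thus ?thesis by (simp only: of_real_eq_iff)
  qed
  have "4 powr (a - 1) * 2 = 2 powr (2 * (a - 1)) * 2 powr (1::real)"
    using powr_powr[of 2 2 "a - 1"] by simp
  also have "\<dots> = inverse (2 powr (1 - 2 * a))"
    by (simp only: powr_add[symmetric] powr_minus[symmetric]) simp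
  also have "2 powr (1 - 2 * a) = exp ((1 - 2 * a) * ln 2)" by (simp add: powr_def)
  finally have four: "4 powr (a - 1) * 2 * exp ((1 - 2 * a) * ln 2) = 1" by simp
  have "4 powr (a - 1) * (2 * Beta a a) = 4 powr (a - 1) * 2 * (Gamma a * Gamma a / Gamma (2 * a))"
    by (simp add: Beta_def)
  \<comment> \<open>The duplication formula removes \<open>Gamma (2 * a)\<close>; its power of 2 cancels the one in front.\<close>
  also have "\<dots> = 4 powr (a - 1) * 2 * exp ((1 - 2 * a) * ln 2) * (sqrt pi * Gamma a / Gamma (a + 1/2))"
    using dup pos by (simp add: field_simps)
  also have "\<dots> = sqrt pi * Gamma a / Gamma (a + 1/2)" unfolding four by simp
  also have "\<dots> = 1 / gegenbauer_const n"
    by (simp add: gegenbauer_const_def a_def field_simps)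
  finally have "4 powr (a - 1) * (2 * Beta a a) = 1 / gegenbauer_const n" .
  with int show ?thesis by simp
qed

text \<open>
  The Sturm--Liouville form of the differential equation says that \<open>(1 - t\<^sup>2)\<^bsup>(n - 1) / 2\<^esup> P\<^sub>k'\<close> has
  derivative \<open>- k (k + n - 2)\<close> times the integrand; it vanishes at both endpoints.  For \<open>n = 2\<close> it
  is continuous on the closed interval but differentiable only in the interior, hence the form of
  the fundamental theorem that is used.
\<close>

lemma gegenbauer_orthogonal_1:
  assumes n: "n \<ge> 2" and k: "k \<ge> 1"
  shows "((\<lambda>t. gegenbauer n k t * (1 - t\<^sup>2) powr ((real n - 3) / 2)) has_integral 0) {-1..1}"
proof -
  define P' where "P' = poly (pderiv (gegenbauer_poly n k))"
  define P'' where "P'' = poly (pderiv (pderiv (gegenbauer_poly n k)))"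
  define e where "e = (real n - 1) / 2"
  define m where "m = real k * (real k + real n - 2)"
  have e: "e > 0" using n by (simp add: e_def)
  have m: "m \<noteq> 0" using n k by (simp add: m_def)
  define G where "G = (\<lambda>t. (1 - t\<^sup>2) powr e * P' t)"
  have "((\<lambda>t. - m * (gegenbauer n k t * (1 - t\<^sup>2) powr (e - 1))) has_integral G 1 - G (-1)) {-1..1}"
  proof (rule fundamental_theorem_of_calculus_interior)
    show "continuous_on {-1..1} G"
      unfolding G_def P'_def using e
      by (intro continuous_on_mult continuous_on_powr' continuous_on_poly continuous_intros ballI)
         (auto simp: abs_square_le_1 abs_le_iff)
    fix t :: real assume t: "t \<in> {-1<..<1}"
    hence pos: "1 - t\<^sup>2 > 0" by (simp add: abs_square_less_1 abs_less_iff)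
    have "(P' has_real_derivative P'' t) (at t)"
      unfolding P'_def P''_def by (rule poly_DERIV)
    hence "(G has_real_derivative
        e * (1 - t\<^sup>2) powr (e - 1) * (- 2 * t) * P' t + (1 - t\<^sup>2) powr e * P'' t) (at t)"
      unfolding G_def using pos
      by (auto intro!: derivative_eq_intros simp: algebra_simps)
    moreover have "(1 - t\<^sup>2) powr e = (1 - t\<^sup>2) * (1 - t\<^sup>2) powr (e - 1)" "2 * e = real n - 1"
      using pos by (simp_all add: powr_diff e_def)
    hence "e * (1 - t\<^sup>2) powr (e - 1) * (- 2 * t) * P' t + (1 - t\<^sup>2) powr e * P'' t =
        (1 - t\<^sup>2) powr (e - 1) * ((1 - t\<^sup>2) * P'' t - (real n - 1) * t * P' t)"
      by algebra
    moreover have "(1 - t\<^sup>2) * P'' t - (real n - 1) * t * P' t = - m * gegenbauer n k t"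
      using gegenbauer_ode[OF n, of t k] by (simp add: P'_def P''_def m_def)
    ultimately show "(G has_vector_derivative - m * (gegenbauer n k t * (1 - t\<^sup>2) powr (e - 1))) (at t)"
      by (simp add: has_real_derivative_iff_has_vector_derivative[symmetric] mult_ac)
  qed simp
  moreover have "G 1 - G (-1) = 0" by (simp add: G_def)
  ultimately have "((\<lambda>t. - m * (gegenbauer n k t * (1 - t\<^sup>2) powr (e - 1))) has_integral - m * 0) {-1..1}"
    by simp
  hence "((\<lambda>t. gegenbauer n k t * (1 - t\<^sup>2) powr (e - 1)) has_integral 0) {-1..1}"
    using has_integral_cmul_iff[of "-m" "\<lambda>t. gegenbauer n k t * (1 - t\<^sup>2) powr (e - 1)" 0] m by simp
  moreover have "e - 1 = (real n - 3) / 2" by (simp add: e_def field_simps)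
  ultimately show ?thesis by simp
qed

text \<open>
  Integration term by term.  Since \<open>\<bar>P\<^sub>k\<bar> \<le> 1 = P\<^sub>k(1)\<close>, the partial sums are bounded by the sum of
  the \<open>\<bar>c k\<bar>\<close>, which is finite by convergence at \<open>t = 1\<close>; hence a multiple of the weight dominates.
\<close>

lemma zeroth_coeff_expansion:
  assumes n: "n \<ge> 2" and card: "CARD('n::finite) = n"
    and c: "\<forall>k\<ge>1. c k \<ge> 0"
    and f: "\<forall>t\<in>{-1..1}. (\<lambda>k. c k * gegenbauer n k t) sums f t"
  shows "zeroth_coeff n f = c 0"
proof -
  define w where "w t = (1 - t\<^sup>2) powr ((real n - 3) / 2)" for t
  have w: "(w has_integral (1 / gegenbauer_const n)) {-1..1}"
    using gegenbauer_weight_integral[OF n] by (simp add: w_def[abs_def])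
  have "summable c" using bspec[OF f, of 1] gegenbauer_at_1[OF n] by (auto simp: sums_iff)
  hence "summable (\<lambda>k. \<bar>c k\<bar>)"
    by (subst summable_cong[of _ c]) (use c in \<open>auto intro: eventually_sequentiallyI[of 1]\<close>)
  define B where "B = (\<Sum>k. \<bar>c k\<bar>)"
  have "((\<lambda>t. f t * w t) has_integral c 0 / gegenbauer_const n) {-1..1}"
  proof (rule has_integral_dominated_convergence)
    show "((\<lambda>t. \<Sum>k<m. c k * (gegenbauer n k t * w t)) has_integral
        (\<Sum>k<m. c k * (if k = 0 then 1 / gegenbauer_const n else 0))) {-1..1}" for m
      using w gegenbauer_orthogonal_1[OF n, folded w_def]
      by (intro has_integral_sum has_integral_mult_right) auto
    show "(\<lambda>t. B * w t) integrable_on {-1..1}"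
      using w by (intro integrable_on_mult_right) auto
    show "\<forall>t\<in>{-1..1}. norm (\<Sum>k<m. c k * (gegenbauer n k t * w t)) \<le> B * w t" for m
    proof
      fix t :: real assume t: "t \<in> {-1..1}"
      have w0: "w t \<ge> 0" by (simp add: w_def)
      have "norm (\<Sum>k<m. c k * (gegenbauer n k t * w t)) \<le> (\<Sum>k<m. \<bar>c k\<bar> * w t)"
        using abs_gegenbauer_le_1[OF n card t] w0
        by (intro sum_norm_le) (auto simp: abs_mult intro!: mult_left_mono mult_left_le_one_le)
      also have "\<dots> \<le> B * w t"
        unfolding B_def sum_distrib_right[symmetric] using \<open>summable (\<lambda>k. \<bar>c k\<bar>)\<close> w0
        by (intro mult_right_mono sum_le_suminf) auto
      finally show "norm (\<Sum>k<m. c k * (gegenbauer n k t * w t)) \<le> B * w t" .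
    qed
    show "\<forall>t\<in>{-1..1}. (\<lambda>m. \<Sum>k<m. c k * (gegenbauer n k t * w t)) \<longlonglongrightarrow> f t * w t"
      using f by (auto simp: sums_def sum_distrib_right[symmetric] mult.assoc[symmetric] intro!: tendsto_mult_right)
    have "(\<Sum>k<m. c k * (if k = 0 then 1 / gegenbauer_const n else 0)) = c 0 / gegenbauer_const n" if "m \<ge> 1" for m
      using that by (simp add: if_distrib[of "\<lambda>z. _ * z"] sum.delta cong: if_cong)
    thus "(\<lambda>m. \<Sum>k<m. c k * (if k = 0 then 1 / gegenbauer_const n else 0)) \<longlonglongrightarrow> c 0 / gegenbauer_const n"
      by (intro tendsto_eventually eventually_sequentiallyI[of 1]) auto
  qed
  moreover have "gegenbauer_const n > 0"
    using n by (auto simp: gegenbauer_const_def intro!: divide_pos_pos mult_pos_pos Gamma_real_pos)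
  ultimately show ?thesis
    by (simp add: zeroth_coeff_def w_def[symmetric] has_integral_iff)
qed

section \<open>The linear programming bound\<close>

text \<open>
  The Delsarte--Yudin argument: in the expansion of the sum of \<open>f\<close> over all pairs of points only the
  term \<open>k = 0\<close> is kept.
\<close>

lemma energy_lower_bound:
  fixes C :: "(real ^ 'n::finite) set"
  assumes n: "n \<ge> 2" and card: "CARD('n) = n" and N: "N \<ge> 1"
    and C: "spherical_code C" "card C = N" and f: "f \<in> admissible n h"
  shows "ereal ((real N)\<^sup>2 * (zeroth_coeff n f - f 1 / real N)) \<le> energy C h"
proof -
  obtain c where fh: "\<forall>t\<in>{-1..1}. ereal (f t) \<le> h t" and c: "\<forall>k\<ge>1. c k \<ge> 0"
    and fc: "\<forall>t\<in>{-1..1}. (\<lambda>k. c k * gegenbauer n k t) sums f t"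
    using f unfolding admissible_def by blast
  have fin: "finite C" and sph: "C \<subseteq> sphere 0 1" using C by (auto simp: spherical_code_def)
  have inn: "x \<bullet> y \<in> {-1..1}" if "x \<in> C" "y \<in> C" for x y
    using Cauchy_Schwarz_ineq2[of x y] that sph by (auto simp: subset_iff abs_le_iff)
  define D where "D = {(x, y). x \<in> C \<and> y \<in> C \<and> x \<noteq> y}"
  have D_sub: "D \<subseteq> C \<times> C" and D_diff: "C \<times> C - D = (\<lambda>x. (x, x)) ` C" by (auto simp: D_def)
  have expansion: "(\<lambda>k. \<Sum>x\<in>C. \<Sum>y\<in>C. c k * gegenbauer n k (x \<bullet> y)) sums (\<Sum>x\<in>C. \<Sum>y\<in>C. f (x \<bullet> y))"
    using fc inn by (intro sums_sum) auto
  have head: "(\<lambda>k. if k = 0 then (real N)\<^sup>2 * c 0 else 0) sums ((real N)\<^sup>2 * c 0)"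
    using sums_single[of 0 "\<lambda>_. (real N)\<^sup>2 * c 0"] by simp
  have "(if k = 0 then (real N)\<^sup>2 * c 0 else 0) \<le> (\<Sum>x\<in>C. \<Sum>y\<in>C. c k * gegenbauer n k (x \<bullet> y))" for k
  proof (cases "k = 0")
    case True
    thus ?thesis using C(2) by (simp add: power2_eq_square)
  next
    case False
    have "0 \<le> c k * (\<Sum>x\<in>C. \<Sum>y\<in>C. gegenbauer n k (x \<bullet> y))"
      using gegenbauer_positive_definite[OF n card sph, of "\<lambda>_. 1" k] c False by simp
    thus ?thesis using False by (simp add: sum_distrib_left)
  qed
  hence ge: "(real N)\<^sup>2 * c 0 \<le> (\<Sum>x\<in>C. \<Sum>y\<in>C. f (x \<bullet> y))"
    by (rule sums_le[OF _ head expansion])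
  have "(\<Sum>x\<in>C. \<Sum>y\<in>C. f (x \<bullet> y)) = (\<Sum>(x, y)\<in>C \<times> C. f (x \<bullet> y))"
    by (simp add: sum.cartesian_product)
  also have "\<dots> = (\<Sum>(x, y)\<in>C \<times> C - D. f (x \<bullet> y)) + (\<Sum>(x, y)\<in>D. f (x \<bullet> y))"
    by (rule sum.subset_diff[OF D_sub]) (use fin in simp)
  also have "(\<Sum>(x, y)\<in>C \<times> C - D. f (x \<bullet> y)) = (\<Sum>x\<in>C. f (x \<bullet> x))"
    unfolding D_diff by (subst sum.reindex) (auto simp: inj_on_def)
  also have "\<dots> = (\<Sum>x\<in>C. f 1)"
    by (intro sum.cong refl) (use sph in \<open>auto simp: norm_eq_1 subset_iff\<close>)
  also have "\<dots> = N * f 1" using C(2) by simp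
  finally have "(real N)\<^sup>2 * c 0 - N * f 1 \<le> (\<Sum>(x, y)\<in>D. f (x \<bullet> y))" using ge by simp
  moreover have "(real N)\<^sup>2 * (zeroth_coeff n f - f 1 / real N) = (real N)\<^sup>2 * c 0 - N * f 1"
    using zeroth_coeff_expansion[OF n card c fc] N by (simp add: power2_eq_square field_simps)
  ultimately have "ereal ((real N)\<^sup>2 * (zeroth_coeff n f - f 1 / real N)) \<le> (\<Sum>(x, y)\<in>D. ereal (f (x \<bullet> y)))"
    by (simp add: case_prod_unfold)
  also have "\<dots> \<le> (\<Sum>(x, y)\<in>D. h (x \<bullet> y))"
    by (intro sum_mono) (use fh inn in \<open>auto simp: D_def\<close>)
  finally show ?thesis unfolding energy_def D_def .
qed

theorem theorem2p3:
  fixes n N k :: nat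
    and h :: "real \<Rightarrow> ereal"
    and \<alpha> \<rho> :: "nat \<Rightarrow> real"
    and \<Lambda> :: "(real \<Rightarrow> real) set"
  assumes "n \<ge> 2" and "CARD('n::finite) = n" and "N \<ge> 2"
    and "\<forall>t\<in>{-1..1}. 0 \<le> h t"
    and "continuous_subspace \<Lambda>"
    and "quadrature_rule k \<alpha> \<rho>"
    and "quadrature_exact n N k \<alpha> \<rho> \<Lambda>"
  shows "(\<forall>f \<in> \<Lambda> \<inter> admissible n h.
            min_energy TYPE('n) N h \<ge> ereal ((real N)\<^sup>2 * (\<Sum>i=1..k. \<rho> i * f (\<alpha> i))))
       \<and> lp_bound n N \<Lambda> h \<le> ereal ((real N)\<^sup>2) * (\<Sum>i=1..k. ereal (\<rho> i) * h (\<alpha> i))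
       \<and> ((\<exists>f \<in> \<Lambda> \<inter> admissible n h. \<forall>i\<in>{1..k}. ereal (f (\<alpha> i)) = h (\<alpha> i)) \<longrightarrow>
            lp_bound n N \<Lambda> h = ereal ((real N)\<^sup>2) * (\<Sum>i=1..k. ereal (\<rho> i) * h (\<alpha> i))
          \<and> min_energy TYPE('n) N h \<ge> ereal ((real N)\<^sup>2) * (\<Sum>i=1..k. ereal (\<rho> i) * h (\<alpha> i)))"
proof -
  \<comment> \<open>\<open>R\<close> is the bound in terms of \<open>h\<close>, and \<open>Q f\<close> the value of the objective at \<open>f\<close> by exactness.\<close>
  define R where "R = ereal ((real N)\<^sup>2) * (\<Sum>i=1..k. ereal (\<rho> i) * h (\<alpha> i))"
  define Q where "Q = (\<lambda>f. (real N)\<^sup>2 * (\<Sum>i=1..k. \<rho> i * f (\<alpha> i)))"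
  have node: "\<alpha> i \<in> {-1..1}" "\<rho> i > 0" if "i \<in> {1..k}" for i
    using assms(6) that by (auto simp: quadrature_rule_def less_imp_le)
  have Q: "(real N)\<^sup>2 * (zeroth_coeff n f - f 1 / real N) = Q f" if "f \<in> \<Lambda>" for f
    using assms(7) that by (simp add: quadrature_exact_def Q_def)
  have Q_ereal: "ereal (Q f) = ereal ((real N)\<^sup>2) * (\<Sum>i=1..k. ereal (\<rho> i) * ereal (f (\<alpha> i)))" for f
    by (simp add: Q_def)
  have energy: "ereal (Q f) \<le> min_energy TYPE('n) N h" if f: "f \<in> \<Lambda> \<inter> admissible n h" for f
    unfolding min_energy_def
    using energy_lower_bound[OF assms(1,2), of N _ f h] f Q[of f] assms(3)
    by (intro INF_greatest) auto
  have lp: "lp_bound n N \<Lambda> h = (SUP f \<in> \<Lambda> \<inter> admissible n h. ereal (Q f))"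
    unfolding lp_bound_def by (intro SUP_cong refl) (simp add: Q)
  have Q_le: "ereal (Q f) \<le> R" if f: "f \<in> \<Lambda> \<inter> admissible n h" for f
    unfolding Q_ereal R_def using f node
    by (intro ereal_mult_left_mono sum_mono) (auto simp: admissible_def less_imp_le)
  have le: "lp_bound n N \<Lambda> h \<le> R" unfolding lp by (intro SUP_least Q_le)
  have "lp_bound n N \<Lambda> h = R \<and> R \<le> min_energy TYPE('n) N h"
    if f: "f \<in> \<Lambda> \<inter> admissible n h" "\<forall>i\<in>{1..k}. ereal (f (\<alpha> i)) = h (\<alpha> i)" for f
  proof -
    have "(\<Sum>i=1..k. ereal (\<rho> i) * h (\<alpha> i)) = (\<Sum>i=1..k. ereal (\<rho> i) * ereal (f (\<alpha> i)))"
      using f(2) by (intro sum.cong) auto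
    hence "R = ereal (Q f)" unfolding Q_ereal R_def by (simp only:)
    thus ?thesis using le energy[OF f(1)] SUP_upper[OF f(1), of "\<lambda>f. ereal (Q f)"]
      unfolding lp by auto
  qed
  with le energy show ?thesis unfolding R_def Q_def by blast
qed

end
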